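(* Let $\mathcal{K}^\gamma(\cdot)$ and $\mathcal{K}^\Gamma(\cdot)$ be the expected running times of the single-time sampling subroutines called by the age-path procedure and by the remaining-lifetime-path procedure, respectively (procedures and cost model are described in the context). Let $n\in\mathbb{N}$ be the number of time points in $t_0<t_1<\cdots<t_n$ and let $h=\max\{t_k-t_{k-1}:k=1,\dots,n\}$ be the maximum step. Assume that the inverses of the cumulative distribution functions of the random variables $\mathcal{S}_v$, $v>0$, are known explicitly. Then the age-path procedure has finite expected running time bounded by $n(\mathcal{K}^\gamma(h)+7)$, while the remaining-lifetime-path procedure has finite expected running time bounded by $n(\mathcal{K}^\Gamma(h)+4)$.
   Context: Let $\sigma$ be a strictly increasing subordinator, $\sigma_0=0$, with drift $b\ge0$ and Lévy measure $\nu$ ($b>0$ or $\nu(0,+\infty)=+\infty$). Put $L_t=\inf\{s>0:\sigma_s>t\}$, $\gamma_t=t-\sigma_{L_t-}$, $\Gamma_t=\sigma_{L_t}-t$. For $v>0$, $\mathcal{S}_v$ has law $\frac{\nu(ds)}{\nu[v,+\infty)}\mathbf{1}_{[s\ge v]}$. Age-path procedure. Input: $x_0\in\mathbb{R}$, $v_0\ge0$ and $t_0<\dots<t_n$. For $i=1,\dots,n$: 1. Set $(x,v)\leftarrow$ the current state (value at $t_{i-1}$). 2. If $v=0$, sample $(L',\gamma')$ with the law of $(L_{t_i-t_{i-1}},\gamma_{t_i-t_{i-1}})$ by the subroutine and set the new state to $(x+L',\gamma')$. 3. If $v\ne0$, sample $\mathcal{S}\sim\mathcal{S}_v$. If $\mathcal{S}\ge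 v+t_i-t_{i-1}$, set the new state to $(x,v+t_i-t_{i-1})$. Otherwise sample $(L',\gamma')$ with the law of $(L_u,\gamma_u)$, $u=t_i-t_{i-1}+v-\mathcal{S}$, by the subroutine and set the new state to $(x+L',\gamma')$. Remaining-lifetime-path procedure. Input: $x_0\in\mathbb{R}$, $r_0\ge0$ and $t_0<\dots<t_n$. For $i=1,\dots,n$: 1. Set $(x,r)\leftarrow$ the current state. 2. If $r>t_i-t_{i-1}$, set the new state to $(x,r-(t_i-t_{i-1}))$. 3. Otherwise sample $(L',\Gamma')$ with the law of $(L_u,\Gamma_u)$, $u=t_i-t_{i-1}-r$, by the subroutine and set the new state to $(x+L',\Gamma')$. Cost model. Each elementary operation (each loop step, each assignment of a state, each if-test, each generation of a uniform random variable, each evaluation of a known function, etc.) costs one; in particular sampling $\mathcal{S}_v$ by inversion costs two. A call to the subroutine sampling $(L_t,\gamma_t)$ (resp. $(L_t,\Gamma_t)$) at a fixed time $t$, under $\sigma_0=0$, has expected running time $\mathcal{K}^\gamma(t)$ (resp. $\mathcal{K}^\Gamma(t)$). The functions $t\mapsto\mathcal{K}^\gamma(t)$ and $t\mapsto\mathcal{K}^\Gamma(t)$ are assumed bounded on bounded intervals and non-decreasing. *)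

theory Defs
  imports "HOL-Probability.Probability"
begin

section \<open>Subordinators, inverse, age and remaining lifetime\<close>

locale subordinator = prob_space M
  for M :: "'w measure" +
  fixes \<sigma> :: "real \<Rightarrow> 'w \<Rightarrow> real"   \<comment> \<open>only times \<open>s \<ge> 0\<close> matter\<close>
    and b :: real
    and \<nu> :: "real measure"
  assumes random_variable: "\<And>s. 0 \<le> s \<Longrightarrow> \<sigma> s \<in> borel_measurable M"
    and start: "\<And>\<omega>. \<omega> \<in> space M \<Longrightarrow> \<sigma> 0 \<omega> = 0"
    and nondecreasing: "\<And>\<omega>. \<omega> \<in> space M \<Longrightarrow> mono_on {0..} (\<lambda>s. \<sigma> s \<omega>)"
    and right_continuous:
      "\<And>\<omega> s. \<omega> \<in> space M \<Longrightarrow> 0 \<le> s \<Longrightarrow> continuous (at_right s) (\<lambda>s. \<sigma> s \<omega>)"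
    and independent_increments:
      "\<And>(n::nat) s. 0 \<le> s 0 \<Longrightarrow> (\<And>k. k < n \<Longrightarrow> s k \<le> s (Suc k)) \<Longrightarrow>
         indep_vars (\<lambda>_. borel) (\<lambda>k \<omega>. \<sigma> (s (Suc k)) \<omega> - \<sigma> (s k) \<omega>) {..<n}"
    and stationary_increments:
      "\<And>s u. 0 \<le> s \<Longrightarrow> 0 \<le> u \<Longrightarrow>
         distr M borel (\<lambda>\<omega>. \<sigma> (s + u) \<omega> - \<sigma> s \<omega>) = distr M borel (\<sigma> u)"
    and drift_nonneg: "0 \<le> b"
    and levy_sets: "sets \<nu> = sets borel"
    and levy_support: "emeasure \<nu> {..0} = 0"
    and levy_integrable: "(\<integral>\<^sup>+ s. ennreal (min 1 s) \<partial>\<nu>) < \<infinity>"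
    and laplace:
      "\<And>s \<theta>. 0 \<le> s \<Longrightarrow> 0 \<le> \<theta> \<Longrightarrow>
         expectation (\<lambda>\<omega>. exp (- \<theta> * \<sigma> s \<omega>)) =
           exp (- s * (b * \<theta> + (\<integral>x. (1 - exp (- \<theta> * x)) \<partial>\<nu>)))"

locale strictly_increasing_subordinator = subordinator +
  assumes strictly_increasing: "AE \<omega> in M. strict_mono_on {0..} (\<lambda>s. \<sigma> s \<omega>)"
    and drift_or_infinite_activity: "0 < b \<or> emeasure \<nu> {0<..} = \<infinity>"

definition inverse_process :: "(real \<Rightarrow> 'w \<Rightarrow> real) \<Rightarrow> real \<Rightarrow> 'w \<Rightarrow> real" where
  "inverse_process \<sigma> t \<omega> = Inf {s. 0 < s \<and> \<sigma> s \<omega> > t}"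

text \<open>The convention at time 0 is \<open>\<sigma>\<^sub>0\<^sub>- = 0\<close>.\<close>

definition left_limit :: "(real \<Rightarrow> 'w \<Rightarrow> real) \<Rightarrow> real \<Rightarrow> 'w \<Rightarrow> real" where
  "left_limit \<sigma> s \<omega> = (if s = 0 then 0 else Lim (at_left s) (\<lambda>r. \<sigma> r \<omega>))"

definition age :: "(real \<Rightarrow> 'w \<Rightarrow> real) \<Rightarrow> real \<Rightarrow> 'w \<Rightarrow> real" where
  "age \<sigma> t \<omega> = t - left_limit \<sigma> (inverse_process \<sigma> t \<omega>) \<omega>"

definition remaining_lifetime :: "(real \<Rightarrow> 'w \<Rightarrow> real) \<Rightarrow> real \<Rightarrow> 'w \<Rightarrow> real" where
  "remaining_lifetime \<sigma> t \<omega> = \<sigma> (inverse_process \<sigma> t \<omega>) \<omega> - t"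

text \<open>
  The law of \<open>\<S>\<^sub>v\<close>, \<open>v > 0\<close>: the Levy measure conditioned on \<open>[v,\<infinity>)\<close>.
  When \<open>\<nu>[v,\<infinity>) = 0\<close> this conditioning is undefined.  The age of the subordinator almost surely
  never takes such a value, so it can only come from the input; we then put \<open>\<S>\<^sub>v = v\<close>, so that
  \<open>\<S>\<^sub>v \<ge> v\<close> in all cases.
\<close>

definition S_law :: "real measure \<Rightarrow> real \<Rightarrow> real measure" where
  "S_law \<nu> v = (if emeasure \<nu> {v..} = 0 then return borel v else uniform_measure \<nu> {v..})"

definition S_inverse_cdf :: "real measure \<Rightarrow> real \<Rightarrow> real \<Rightarrow> real" where
  "S_inverse_cdf \<nu> v u = Inf {s. u \<le> cdf (S_law \<nu> v) s}"

section \<open>Randomized procedures with running time\<close>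

text \<open>
  A randomized procedure is given by the joint law of its output and its running time, the latter
  counted in elementary operations.  The output and the running time may be dependent.
\<close>

type_synonym 'a timed = "('a \<times> ennreal) measure"

definition expected_time :: "'a timed \<Rightarrow> ennreal" where
  "expected_time m = (\<integral>\<^sup>+ z. snd z \<partial>m)"

definition output_law :: "'a::topological_space timed \<Rightarrow> 'a measure" where
  "output_law m = distr m borel fst"

text \<open>Deterministic output or random draw, before any cost is charged.\<close>

definition result :: "'a::topological_space \<Rightarrow> 'a timed" where
  "result a = return borel (a, 0)"

definition draw :: "'a::topological_space measure \<Rightarrow> 'a timed" where
  "draw N = distr N borel (\<lambda>a. (a, 0))"

text \<open>Charge one elementary operation.\<close>

definition tick :: "'a::topological_space timed \<Rightarrow> 'a timed" where
  "tick m = distr m borel (\<lambda>(a, c). (a, 1 + c))"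

text \<open>Run \<open>m\<close>, then \<open>f\<close> on its output with fresh randomness; running times add up.\<close>

definition seq :: "'a timed \<Rightarrow> ('a \<Rightarrow> 'b::topological_space timed) \<Rightarrow> 'b timed" where
  "seq m f = bind m (\<lambda>(a, c). distr (f a) borel (\<lambda>(y, d). (y, c + d)))"

text \<open>
  A subroutine which, called at a time \<open>u \<ge> 0\<close>, outputs a sample of \<open>law u\<close>.
  Measurability in \<open>u\<close> is what makes calling it at a random time meaningful.
\<close>

definition sampling_subroutine ::
    "(real \<Rightarrow> 'a::topological_space measure) \<Rightarrow> (real \<Rightarrow> 'a timed) \<Rightarrow> bool" where
  "sampling_subroutine law sub \<longleftrightarrow>
     sub \<in> restrict_space borel {0..} \<rightarrow>\<^sub>M prob_algebra borel \<and>
     (\<forall>u\<ge>0. output_law (sub u) = law u)"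

text \<open>Inversion: one operation for the uniform variable, one for the evaluation of the inverse
  distribution function.\<close>

definition sample_S :: "real measure \<Rightarrow> real \<Rightarrow> real timed" where
  "sample_S \<nu> v =
     seq (tick (draw (uniform_measure lborel {0<..<1})))
       (\<lambda>u. tick (result (S_inverse_cdf \<nu> v u)))"

section \<open>The two path procedures\<close>

text \<open>
  A path assigns to each index \<open>i\<close> the state at time \<open>t\<^sub>i\<close>; the entries beyond the last
  treated index are irrelevant.  In each loop pass one operation is charged for the loop step, one
  for reading the current state, one for each if-test and one for setting the new state.
\<close>

type_synonym path = "nat \<Rightarrow> real \<times> real"

definition set_state :: "nat \<Rightarrow> real \<times> real \<Rightarrow> path \<Rightarrow> path timed" where
  "set_state i s p = tick (result (p(i := s)))"

definition renew ::
    "(real \<Rightarrow> (real \<times> real) timed) \<Rightarrow> real \<Rightarrow> nat \<Rightarrow> real \<Rightarrow> path \<Rightarrow> path timed" where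
  "renew sub u i x p = seq (sub u) (\<lambda>(l, g). set_state i (x + l, g) p)"

definition age_step ::
    "real measure \<Rightarrow> (real \<Rightarrow> (real \<times> real) timed) \<Rightarrow> (nat \<Rightarrow> real) \<Rightarrow>
     nat \<Rightarrow> path \<Rightarrow> path timed" where
  "age_step \<nu> sub t i p = tick (tick (
     let (x, v) = p (i - 1); d = t i - t (i - 1) in
     tick (if v = 0 then renew sub d i x p
       else seq (sample_S \<nu> v) (\<lambda>S.
         tick (if S \<ge> v + d then set_state i (x, v + d) p
               else renew sub (d + v - S) i x p)))))"

definition lifetime_step ::
    "(real \<Rightarrow> (real \<times> real) timed) \<Rightarrow> (nat \<Rightarrow> real) \<Rightarrow> nat \<Rightarrow> path \<Rightarrow> path timed" where
  "lifetime_step sub t i p = tick (tick (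
     let (x, r) = p (i - 1); d = t i - t (i - 1) in
     tick (if r > d then set_state i (x, r - d) p
           else renew sub (d - r) i x p)))"

text \<open>\<open>run_loop step s n\<close> executes \<open>step i\<close> for \<open>i = 1, \<dots>, n\<close>, starting from the state \<open>s\<close> at
  index 0.\<close>

primrec run_loop :: "(nat \<Rightarrow> path \<Rightarrow> path timed) \<Rightarrow> real \<times> real \<Rightarrow> nat \<Rightarrow> path timed" where
  "run_loop step s 0 = result (\<lambda>_. s)"
| "run_loop step s (Suc n) = seq (run_loop step s n) (step (Suc n))"

definition age_path_procedure ::
    "real measure \<Rightarrow> (real \<Rightarrow> (real \<times> real) timed) \<Rightarrow> real \<Rightarrow> real \<Rightarrow> (nat \<Rightarrow> real) \<Rightarrow> nat \<Rightarrow>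
     path timed" where
  "age_path_procedure \<nu> sub x0 v0 t n = run_loop (age_step \<nu> sub t) (x0, v0) n"

definition lifetime_path_procedure ::
    "(real \<Rightarrow> (real \<times> real) timed) \<Rightarrow> real \<Rightarrow> real \<Rightarrow> (nat \<Rightarrow> real) \<Rightarrow> nat \<Rightarrow> path timed" where
  "lifetime_path_procedure sub x0 r0 t n = run_loop (lifetime_step sub t) (x0, r0) n"

end

theory Submission
  imports Defs
begin

text \<open>
  Each loop pass calls the subroutine at most once, and at a time between \<open>0\<close> and the length of the
  step: a current age or remaining lifetime is almost surely nonnegative, and a sample of \<open>\<S>\<^sub>v\<close> is
  at least \<open>v\<close>.  By monotonicity a call costs at most \<open>K h\<close> on average, and the elementary operations
  of a pass number at most 7, respectively 4.  Nonnegativity of the state is the loop invariant; it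
  holds because the subordinator almost surely exceeds every level, its Laplace exponent being
  positive at 1, so that \<open>L\<^sub>u\<close> is the infimum of a nonempty set.
\<close>

section \<open>Measurability and running time of randomized procedures\<close>

text \<open>Timed results carry the Borel sigma-algebra of the product topology, and the projections
  are continuous.\<close>

lemma measurable_fst_borel [measurable (raw)]:
  fixes f :: "'c \<Rightarrow> 'a::topological_space \<times> 'b::topological_space"
  assumes "f \<in> N \<rightarrow>\<^sub>M borel"
  shows "(\<lambda>x. fst (f x)) \<in> N \<rightarrow>\<^sub>M borel"
  by (rule measurable_compose[OF assms])
     (intro borel_measurable_continuous_onI continuous_on_fst continuous_on_id)

lemma measurable_snd_borel [measurable (raw)]:
  fixes f :: "'c \<Rightarrow> 'a::topological_space \<times> 'b::topological_space"
  assumes "f \<in> N \<rightarrow>\<^sub>M borel"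
  shows "(\<lambda>x. snd (f x)) \<in> N \<rightarrow>\<^sub>M borel"
  by (rule measurable_compose[OF assms])
     (intro borel_measurable_continuous_onI continuous_on_snd continuous_on_id)

lemma measurable_tick [measurable (raw)]:
  fixes m :: "'c \<Rightarrow> 'a::second_countable_topology timed"
  assumes "m \<in> N \<rightarrow>\<^sub>M prob_algebra borel"
  shows "(\<lambda>x. tick (m x)) \<in> N \<rightarrow>\<^sub>M prob_algebra borel"
  unfolding tick_def by (rule measurable_distr_prob_space2[OF assms]) (simp add: split_beta')

lemma measurable_result [measurable (raw)]:
  fixes a :: "'c \<Rightarrow> 'a::second_countable_topology"
  assumes [measurable]: "a \<in> N \<rightarrow>\<^sub>M borel"
  shows "(\<lambda>x. result (a x)) \<in> N \<rightarrow>\<^sub>M prob_algebra borel"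
proof -
  have "(\<lambda>x. (a x, 0::ennreal)) \<in> N \<rightarrow>\<^sub>M borel"
    by measurable
  then show ?thesis
    unfolding result_def by (rule measurable_compose[OF _ measurable_return_prob_space])
qed

text \<open>Joint measurability in the parameter and the intermediate output lets the continuation
  depend on earlier random values, as nested calls of \<open>seq\<close> require.\<close>

lemma measurable_seq [measurable (raw)]:
  fixes m :: "'c \<Rightarrow> 'a::second_countable_topology timed"
    and f :: "'c \<Rightarrow> 'a \<Rightarrow> 'b::second_countable_topology timed"
  assumes [measurable]: "m \<in> N \<rightarrow>\<^sub>M prob_algebra borel"
    and f: "(\<lambda>(x, a). f x a) \<in> N \<Otimes>\<^sub>M borel \<rightarrow>\<^sub>M prob_algebra borel"
  shows "(\<lambda>x. seq (m x) (f x)) \<in> N \<rightarrow>\<^sub>M prob_algebra borel"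
proof -
  have "(\<lambda>w. f (fst w) (fst (snd w))) \<in> N \<Otimes>\<^sub>M (borel :: ('a \<times> ennreal) measure) \<rightarrow>\<^sub>M prob_algebra borel"
    using measurable_compose[OF _ f, of "\<lambda>w. (fst w, fst (snd w))" "N \<Otimes>\<^sub>M borel"]
    by (simp add: split_beta)
  then have "(\<lambda>w. distr (f (fst w) (fst (snd w))) borel (\<lambda>(y, d). (y, snd (snd w) + d)))
      \<in> N \<Otimes>\<^sub>M (borel :: ('a \<times> ennreal) measure) \<rightarrow>\<^sub>M prob_algebra borel"
    by (rule measurable_distr_prob_space2) (simp add: split_beta')
  then show ?thesis
    unfolding seq_def
    by (intro measurable_bind_prob_space2[OF assms(1)]) (simp add: split_beta')
qed

lemma draw_in_prob_algebra:
  fixes D :: "'a::second_countable_topology measure"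
  assumes "prob_space D" and [measurable_cong]: "sets D = sets borel"
  shows "draw D \<in> space (prob_algebra borel)"
proof -
  have "(\<lambda>a. (a, 0::ennreal)) \<in> D \<rightarrow>\<^sub>M borel"
    by measurable
  from prob_space.prob_space_distr[OF assms(1) this] show ?thesis
    by (simp add: space_prob_algebra draw_def)
qed

text \<open>Cost adds up linearly in the mean because \<open>m\<close> has mass one. Almost sure
  statements concern the output \<open>fst z\<close> only, so charging an operation does not affect
  them.\<close>

lemma
  fixes m :: "'a::second_countable_topology timed"
  assumes "m \<in> space (prob_algebra borel)"
  shows expected_time_tick: "expected_time (tick m) = 1 + expected_time m"
    and AE_tick: "Measurable.pred borel P \<Longrightarrow> (AE z in tick m. P (fst z)) \<longleftrightarrow> (AE z in m. P (fst z))"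
proof -
  interpret m: prob_space m
    using assms by (simp add: space_prob_algebra)
  have [measurable_cong]: "sets m = sets borel"
    using assms by (simp add: space_prob_algebra)
  show "expected_time (tick m) = 1 + expected_time m"
    unfolding expected_time_def tick_def
    by (subst nn_integral_distr) (simp_all add: split_beta' nn_integral_add m.emeasure_space_1)
  show "(AE z in tick m. P (fst z)) \<longleftrightarrow> (AE z in m. P (fst z))" if [measurable]: "Measurable.pred borel P"
    unfolding tick_def
    by (subst AE_distr_iff) (simp_all add: split_beta')
qed

lemma
  fixes a :: "'a::second_countable_topology"
  shows expected_time_result: "expected_time (result a) = 0"
    and AE_result: "Measurable.pred borel P \<Longrightarrow> (AE z in result a. P (fst z)) \<longleftrightarrow> P a"
proof -
  show "expected_time (result a) = 0"
    unfolding expected_time_def result_def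
    by (subst nn_integral_return) simp_all
  show "(AE z in result a. P (fst z)) \<longleftrightarrow> P a" if [measurable]: "Measurable.pred borel P"
    unfolding result_def
    by (subst AE_return) simp_all
qed

lemma
  fixes D :: "'a::second_countable_topology measure"
  assumes [measurable_cong]: "sets D = sets borel"
  shows expected_time_draw: "expected_time (draw D) = 0"
    and AE_draw: "Measurable.pred borel P \<Longrightarrow> (AE z in draw D. P (fst z)) \<longleftrightarrow> (AE a in D. P a)"
proof -
  show "expected_time (draw D) = 0"
    unfolding expected_time_def draw_def
    by (subst nn_integral_distr) simp_all
  show "(AE z in draw D. P (fst z)) \<longleftrightarrow> (AE a in D. P a)" if [measurable]: "Measurable.pred borel P"
    unfolding draw_def
    by (subst AE_distr_iff) simp_all
qed

text \<open>Integration against a bind is iterated integration. Linearity of the integral adds the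
  two running times, although the second may depend on the output of the first.\<close>

lemma
  fixes m :: "'a::second_countable_topology timed"
    and f :: "'a \<Rightarrow> 'b::second_countable_topology timed"
  assumes m: "m \<in> space (prob_algebra borel)"
    and f [measurable]: "f \<in> borel \<rightarrow>\<^sub>M prob_algebra borel"
  shows expected_time_seq:
      "expected_time (seq m f) = expected_time m + (\<integral>\<^sup>+ z. expected_time (f (fst z)) \<partial>m)"
    and AE_seq: "Measurable.pred borel P \<Longrightarrow>
      (AE w in seq m f. P (fst w)) \<longleftrightarrow> (AE z in m. AE w in f (fst z). P (fst w))"
proof -
  have sm [measurable_cong]: "sets m = sets borel"
    using m by (simp add: space_prob_algebra)
  have sf [measurable_cong]: "sets (f a) = sets borel" and pf: "prob_space (f a)" for a
    using measurable_space[OF f, of a] by (simp_all add: space_prob_algebra)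
  have add [measurable]: "(\<lambda>(y, d). (y, c + d)) \<in> f a \<rightarrow>\<^sub>M borel" for a and c :: ennreal
    unfolding split_beta' by measurable
  have "(\<lambda>z. f (fst z)) \<in> m \<rightarrow>\<^sub>M prob_algebra borel"
    by measurable
  then have "(\<lambda>z. distr (f (fst z)) borel (\<lambda>(y, d). (y, snd z + d))) \<in> m \<rightarrow>\<^sub>M prob_algebra borel"
    by (rule measurable_distr_prob_space2) (simp add: split_beta')
  then have k: "(\<lambda>(a, c). distr (f a) borel (\<lambda>(y, d). (y, c + d))) \<in> m \<rightarrow>\<^sub>M subprob_algebra borel"
    by (intro measurable_prob_algebraD) (simp add: split_beta')
  have [measurable]: "(\<lambda>a. expected_time (f a)) \<in> borel_measurable borel"
    unfolding expected_time_def
    by (rule measurable_compose[OF measurable_prob_algebraD[OF f]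
          nn_integral_measurable_subprob_algebra]) simp
  \<comment> \<open>The cost \<open>c\<close> spent so far comes out as it stands because
    \<open>f a\<close> has total mass one.\<close>
  have inner: "(\<integral>\<^sup>+ y. snd y \<partial>distr (f a) borel (\<lambda>(y, d). (y, c + d))) = c + expected_time (f a)"
    for a c
  proof -
    interpret prob_space "f a" by (rule pf)
    show ?thesis
      by (subst nn_integral_distr[OF add])
         (simp_all add: split_beta' nn_integral_add expected_time_def emeasure_space_1)
  qed
  have "expected_time (seq m f) = (\<integral>\<^sup>+ z. snd z + expected_time (f (fst z)) \<partial>m)"
    unfolding seq_def expected_time_def[of "bind _ _"]
    by (subst nn_integral_bind[OF _ k]) (simp_all add: inner split_beta)
  also have "\<dots> = expected_time m + (\<integral>\<^sup>+ z. expected_time (f (fst z)) \<partial>m)"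
    unfolding expected_time_def[of m] by (rule nn_integral_add) simp_all
  finally show "expected_time (seq m f) = expected_time m + (\<integral>\<^sup>+ z. expected_time (f (fst z)) \<partial>m)" .
  show "(AE w in seq m f. P (fst w)) \<longleftrightarrow> (AE z in m. AE w in f (fst z). P (fst w))"
    if [measurable]: "Measurable.pred borel P"
  proof -
    have P: "Measurable.pred borel (\<lambda>w :: 'b \<times> ennreal. P (fst w))"
      by measurable
    have eq: "(AE w in distr (f a) borel (\<lambda>(y, d). (y, c + d)). P (fst w)) \<longleftrightarrow> (AE w in f a. P (fst w))"
      for a c
      by (subst AE_distr_iff[OF add]) (use P in \<open>simp_all add: split_beta' pred_def\<close>)
    have "(AE w in seq m f. P (fst w)) \<longleftrightarrow>
        (AE z in m. AE w in (case z of (a, c) \<Rightarrow> distr (f a) borel (\<lambda>(y, d). (y, c + d))). P (fst w))"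
      unfolding seq_def by (rule AE_bind[OF k P])
    also have "\<dots> \<longleftrightarrow> (AE z in m. AE w in f (fst z). P (fst w))"
      by (intro AE_cong) (simp only: split_beta[of "\<lambda>a c. distr (f a) borel (\<lambda>(y, d). (y, c + d))"] eq)
    finally show ?thesis .
  qed
qed

text \<open>The bound on the continuation is asked only for almost every output, which is how the
  loop invariant and the lower bound on the sample of S enter.\<close>

lemma expected_time_seq_le:
  fixes m :: "'a::second_countable_topology timed"
    and f :: "'a \<Rightarrow> 'b::second_countable_topology timed"
  assumes m: "m \<in> space (prob_algebra borel)"
    and f: "f \<in> borel \<rightarrow>\<^sub>M prob_algebra borel"
    and C: "AE z in m. expected_time (f (fst z)) \<le> C"
  shows "expected_time (seq m f) \<le> expected_time m + C"
proof -
  interpret prob_space m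
    using m by (simp add: space_prob_algebra)
  have "(\<integral>\<^sup>+ z. expected_time (f (fst z)) \<partial>m) \<le> (\<integral>\<^sup>+ z. C \<partial>m)"
    by (rule nn_integral_mono_AE[OF C])
  then show ?thesis
    by (simp add: expected_time_seq[OF m f] emeasure_space_1)
qed

text \<open>Induction on the number of passes carries the cost bound together with the almost sure
  invariant \<open>P\<close> for the last state written. Pass \<open>Suc i\<close> has its cost
  bounded when the state at \<open>i\<close> satisfies \<open>P\<close>, and then establishes
  \<open>P\<close> at \<open>Suc i\<close>.\<close>

lemma run_loop_bound:
  assumes step: "\<And>i. step (Suc i) \<in> borel \<rightarrow>\<^sub>M prob_algebra borel"
    and s: "P s" and P: "Measurable.pred borel P"
    and cost: "\<And>i p. i < n \<Longrightarrow> P (p i) \<Longrightarrow> expected_time (step (Suc i) p) \<le> C"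
    and inv: "\<And>i p. i < n \<Longrightarrow> P (p i) \<Longrightarrow> AE z in step (Suc i) p. P (fst z (Suc i))"
  shows "expected_time (run_loop step s n) \<le> of_nat n * C"
proof -
  have meas_P: "Measurable.pred borel (\<lambda>p :: path. P (p i))" for i
    by (rule measurable_compose[OF measurable_product_coordinates P])
  have space: "run_loop step s k \<in> space (prob_algebra borel)" for k
  proof (induction k)
    case 0
    \<comment> \<open>Measurability rules speak of kernels; a kernel constant on the real line turns
      them into membership in the space of probability measures.\<close>
    have "(\<lambda>x. result (\<lambda>_::nat. s)) \<in> (borel :: real measure) \<rightarrow>\<^sub>M prob_algebra borel"
      by measurable
    from measurable_space[OF this, of 0] show ?case by simp
  next
    case (Suc k)
    have "(\<lambda>x. seq (run_loop step s k) (step (Suc k))) \<in> (borel :: real measure) \<rightarrow>\<^sub>M prob_algebra borel"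
      by (rule measurable_seq)
         (use Suc step in \<open>auto simp: split_beta' intro: measurable_compose[OF measurable_snd]\<close>)
    from measurable_space[OF this, of 0] show ?case by simp
  qed
  have "k \<le> n \<Longrightarrow> expected_time (run_loop step s k) \<le> of_nat k * C \<and>
      (AE z in run_loop step s k. P (fst z k))" for k
  proof (induction k)
    case 0
    show ?case
      using s by (subst (1 2) run_loop.simps) (simp only: expected_time_result AE_result[OF meas_P] simp_thms, simp)
  next
    case (Suc k)
    then have IH: "expected_time (run_loop step s k) \<le> of_nat k * C"
      "AE z in run_loop step s k. P (fst z k)" and k: "k < n"
      by auto
    have "expected_time (run_loop step s (Suc k)) \<le> expected_time (run_loop step s k) + C"
      unfolding run_loop.simps
      by (rule expected_time_seq_le[OF space step]) (use IH(2) cost[OF k] in auto)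
    also have "\<dots> \<le> of_nat k * C + C"
      using IH(1) by (rule add_right_mono)
    finally have "expected_time (run_loop step s (Suc k)) \<le> of_nat (Suc k) * C"
      by (simp add: distrib_right add.commute)
    moreover have "AE z in run_loop step s (Suc k). P (fst z (Suc k))"
      unfolding run_loop.simps AE_seq[OF space step meas_P]
      using IH(2) by eventually_elim (rule inv[OF k])
    ultimately show ?case by blast
  qed
  then show ?thesis by blast
qed

section \<open>Inversion sampling of the conditioned Levy measure\<close>

text \<open>Strict sublevel sets of such a function are up-sets, hence intervals.\<close>

lemma borel_measurable_antimono_ennreal:
  fixes g :: "real \<Rightarrow> ennreal"
  assumes "antimono g"
  shows "g \<in> borel_measurable borel"
proof (rule borel_measurableI_less)
  fix y
  have "is_interval {x. g x < y}"
    unfolding is_interval_1 using antimonoD[OF assms] by (auto intro: le_less_trans)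
  then show "{x \<in> space borel. g x < y} \<in> sets borel"
    by (simp add: real_interval_borel_measurable)
qed

context
  fixes \<nu> :: "real measure"
  assumes sets_\<nu>: "sets \<nu> = sets borel"
begin

lemma cdf_S_law:
  "cdf (S_law \<nu> v) s =
    (if emeasure \<nu> {v..} = 0 then if v \<le> s then 1 else 0
     else enn2real (emeasure \<nu> ({v..} \<inter> {..s}) / emeasure \<nu> {v..}))"
  by (cases "emeasure \<nu> {v..} = 0")
     (simp_all add: S_law_def cdf_def measure_def sets_\<nu> indicator_def)

lemma cdf_S_law_below: "s < v \<Longrightarrow> cdf (S_law \<nu> v) s = 0"
proof -
  assume "s < v"
  then have "{v..} \<inter> {..s} = {}" by auto
  with \<open>s < v\<close> show ?thesis by (simp only: cdf_S_law) simp
qed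

text \<open>This covers all real \<open>v\<close>, even those with an infinite tail: the total mass
  of \<open>uniform_measure\<close> has the form a / a, which is 0 or 1 in
  \<open>ennreal\<close>.\<close>

lemma finite_borel_measure_S_law: "finite_borel_measure (S_law \<nu> v)"
proof (intro finite_borel_measure.intro finite_measureI finite_borel_measure_axioms.intro)
  show "sets (S_law \<nu> v) = sets borel"
    by (simp add: S_law_def sets_\<nu>)
  have "space \<nu> = UNIV"
    using sets_eq_imp_space_eq[OF sets_\<nu>] by simp
  moreover have "a / a \<noteq> (\<top>::ennreal)" for a
    by (cases "a = 0 \<or> a = \<top>") (auto simp: ennreal_divide_self less_top)
  ultimately show "emeasure (S_law \<nu> v) (space (S_law \<nu> v)) \<noteq> \<infinity>"
    unfolding S_law_def using emeasure_uniform_measure[of "{v..}" \<nu> UNIV]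
    by (auto simp: sets_\<nu> emeasure_return)
qed

lemma cdf_S_law_mono: "s \<le> s' \<Longrightarrow> cdf (S_law \<nu> v) s \<le> cdf (S_law \<nu> v) s'"
  by (rule finite_borel_measure.cdf_nondecreasing[OF finite_borel_measure_S_law])

lemma cdf_S_law_nonneg: "0 \<le> cdf (S_law \<nu> v) s"
  by (simp add: cdf_def)

text \<open>By \<open>cdf_S_law\<close>, \<open>v\<close> enters only through a comparison with
  \<open>s\<close> and through two masses that are antitone in \<open>v\<close>.\<close>

lemma measurable_cdf_S_law [measurable]: "(\<lambda>v. cdf (S_law \<nu> v) s) \<in> borel_measurable borel"
proof -
  have [measurable]: "(\<lambda>v. emeasure \<nu> {v..}) \<in> borel_measurable borel"
    "(\<lambda>v. emeasure \<nu> ({v..} \<inter> {..s})) \<in> borel_measurable borel"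
    by (rule borel_measurable_antimono_ennreal, intro antimonoI emeasure_mono,
        auto simp: sets_\<nu>)+
  show ?thesis
    unfolding cdf_S_law by measurable
qed

text \<open>
  The defining set of the inverse distribution function is all of \<open>\<real>\<close> for \<open>u \<le> 0\<close> and may be empty for
  \<open>u \<ge> 1\<close>; the junk value of \<open>Inf\<close> is then a constant.  Otherwise the set is an up-set bounded below
  by \<open>v\<close>, and the distribution function is only compared with \<open>u\<close> at rational points.
\<close>

lemma S_inverse_cdf_less_iff:
  "S_inverse_cdf \<nu> v u < a \<longleftrightarrow>
    (if u \<le> 0 then Inf (UNIV :: real set) < a
     else if \<forall>m::nat. \<not> u \<le> cdf (S_law \<nu> v) (real m) then Inf ({} :: real set) < a
     else \<exists>q::rat. of_rat q < a \<and> u \<le> cdf (S_law \<nu> v) (of_rat q))"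
proof -
  define A where "A = {s. u \<le> cdf (S_law \<nu> v) s}"
  have mem: "u \<le> cdf (S_law \<nu> v) s \<longleftrightarrow> s \<in> A" for s
    by (simp add: A_def)
  have up: "s' \<in> A" if "s \<in> A" "s \<le> s'" for s s'
    using that cdf_S_law_mono[of s s' v] by (simp add: A_def)
  have "A = UNIV" if "u \<le> 0"
    using that cdf_S_law_nonneg[of v] by (auto simp: A_def intro: order_trans)
  \<comment> \<open>An up-set without natural numbers is empty, so emptiness becomes a countable
    condition.\<close>
  moreover have "A = {}" if "\<forall>m::nat. real m \<notin> A"
    using that up real_arch_simple by blast
  moreover have "Inf A < a \<longleftrightarrow> (\<exists>q::rat. of_rat q < a \<and> of_rat q \<in> A)" if "0 < u" "A \<noteq> {}"
  proof -
    have "bdd_below A"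
      using that(1) cdf_S_law_below[of _ v]
      by (intro bdd_belowI[of _ v] leI) (auto simp: A_def)
    then have "Inf A < a \<longleftrightarrow> (\<exists>s\<in>A. s < a)"
      using that(2) by (rule cInf_less_iff[rotated])
    also have "\<dots> \<longleftrightarrow> (\<exists>q::rat. of_rat q < a \<and> of_rat q \<in> A)"
      using of_rat_dense up by (meson less_imp_le)
    finally show ?thesis .
  qed
  ultimately show ?thesis
    unfolding S_inverse_cdf_def mem Collect_mem_eq by (cases "A = {}") auto
qed

text \<open>Joint measurability is needed because the sample is drawn at a random age
  \<open>v\<close>.\<close>

lemma measurable_S_inverse_cdf [measurable]:
  "(\<lambda>(v, u). S_inverse_cdf \<nu> v u) \<in> borel_measurable (borel \<Otimes>\<^sub>M borel)"
  unfolding borel_measurable_iff_less split_beta S_inverse_cdf_less_iff by measurable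

end

section \<open>Lower bound for samples obtained by inversion\<close>

context subordinator
begin

text \<open>Markov's inequality for the integrable function \<open>min 1 s\<close>.\<close>

lemma emeasure_levy_atLeast_finite:
  assumes "0 < v"
  shows "emeasure \<nu> {v..} < \<infinity>"
proof -
  have "ennreal (min 1 v) * emeasure \<nu> {v..} = (\<integral>\<^sup>+ s. ennreal (min 1 v) * indicator {v..} s \<partial>\<nu>)"
    by (simp add: levy_sets nn_integral_cmult_indicator)
  also have "\<dots> \<le> (\<integral>\<^sup>+ s. ennreal (min 1 s) \<partial>\<nu>)"
    by (intro nn_integral_mono) (auto simp: indicator_def intro!: ennreal_leI)
  also have "\<dots> < \<infinity>"
    by (rule levy_integrable)
  finally show ?thesis
    using assms by (auto simp: ennreal_mult_less_top)
qed

text \<open>The distribution function vanishes below \<open>v\<close>, so \<open>v\<close> is a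
  lower bound of the set whose infimum is taken. The set is nonempty since the tail mass is finite,
  so that the distribution function tends to 1.\<close>

lemma S_inverse_cdf_ge:
  assumes v: "0 < v" and u: "0 < u" "u < 1"
  shows "v \<le> S_inverse_cdf \<nu> v u"
proof -
  interpret S: finite_borel_measure "S_law \<nu> v"
    by (rule finite_borel_measure_S_law[OF levy_sets])
  have "prob_space (S_law \<nu> v)"
    using emeasure_levy_atLeast_finite[OF v]
    by (auto simp: S_law_def intro!: prob_space_return prob_space_uniform_measure)
  then have "(\<lambda>i. cdf (S_law \<nu> v) (real i)) \<longlonglongrightarrow> 1"
    using S.cdf_lim_infty by (simp add: prob_space.prob_space)
  from order_tendstoD(1)[OF this u(2)] obtain i where "u < cdf (S_law \<nu> v) (real i)"
    by (auto simp: eventually_sequentially)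
  then have "real i \<in> {s. u \<le> cdf (S_law \<nu> v) s}"
    by simp
  moreover have "v \<le> s" if "u \<le> cdf (S_law \<nu> v) s" for s
    using that u(1) cdf_S_law_below[OF levy_sets, of s v] by (cases "s < v") auto
  ultimately show ?thesis
    unfolding S_inverse_cdf_def by (intro cInf_greatest) auto
qed

end

section \<open>Sign of age and remaining lifetime\<close>

context strictly_increasing_subordinator
begin

lemma laplace_exponent_pos: "0 < b + (\<integral>x. (1 - exp (- x)) \<partial>\<nu>)"
proof -
  have [measurable_cong]: "sets \<nu> = sets borel"
    by (rule levy_sets)
  have "{..0} \<in> null_sets \<nu>"
    using levy_support levy_sets by (simp add: null_sets_def)
  then have pos: "AE x in \<nu>. 0 < x"
    by (rule AE_I'[of "{..0}"]) auto
  then have nonneg: "AE x in \<nu>. 0 \<le> 1 - exp (- x)"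
    by eventually_elim simp
  then have "0 \<le> (\<integral>x. (1 - exp (- x)) \<partial>\<nu>)"
    by (rule integral_nonneg_AE)
  moreover have "(\<integral>x. (1 - exp (- x)) \<partial>\<nu>) \<noteq> 0" if inf: "emeasure \<nu> {0<..} = \<infinity>"
  proof
    \<comment> \<open>Integrability matters because a Bochner integral of a non-integrable function
      is 0 by convention. The dominating function is \<open>min 1 x\<close>, by
      \<open>1 - x \<le> exp (- x)\<close>.\<close>
    have "integrable \<nu> (\<lambda>x. 1 - exp (- x))"
    proof (rule integrableI_bounded)
      have "(\<integral>\<^sup>+ x. ennreal (norm (1 - exp (- x))) \<partial>\<nu>) \<le> (\<integral>\<^sup>+ x. ennreal (min 1 x) \<partial>\<nu>)"
      proof (rule nn_integral_mono_AE)
        show "AE x in \<nu>. ennreal (norm (1 - exp (- x))) \<le> ennreal (min 1 x)"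
          using pos
        proof eventually_elim
          case (elim x)
          show ?case
            using elim exp_ge_add_one_self[of "- x"] by (intro ennreal_leI) auto
        qed
      qed
      also have "\<dots> < \<infinity>"
        by (rule levy_integrable)
      finally show "(\<integral>\<^sup>+ x. ennreal (norm (1 - exp (- x))) \<partial>\<nu>) < \<infinity>" .
    qed measurable
    moreover assume "(\<integral>x. (1 - exp (- x)) \<partial>\<nu>) = 0"
    ultimately have "AE x in \<nu>. 1 - exp (- x) = 0"
      using integral_nonneg_eq_0_iff_AE[OF _ nonneg] by simp
    with pos have "AE x in \<nu>. x \<notin> {0<..}"
      by eventually_elim auto
    then have "emeasure \<nu> {0<..} = 0"
      by (subst (asm) AE_iff_measurable[of "{0<..}"]) (auto simp: levy_sets sets_eq_imp_space_eq[OF levy_sets])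
    with inf show False by simp
  qed
  ultimately show ?thesis
    using drift_or_infinite_activity drift_nonneg by (auto simp: less_le)
qed

text \<open>Chernoff bound at parameter 1: the path stays below \<open>u\<close> up to time n with
  probability at most \<open>exp (u - n * \<Phi>)\<close>, which tends to 0 since
  \<open>\<Phi>\<close> is positive.\<close>

lemma AE_exceeds: "AE \<omega> in M. \<exists>s>0. u < \<sigma> s \<omega>" if "0 \<le> u"
proof -
  define \<Phi> where "\<Phi> = b + (\<integral>x. (1 - exp (- x)) \<partial>\<nu>)"
  \<comment> \<open>Integer times make the event a countable intersection, hence measurable.\<close>
  define B where "B = {\<omega> \<in> space M. \<forall>n::nat. \<sigma> (real n) \<omega> \<le> u}"
  have [measurable]: "\<sigma> (real n) \<in> borel_measurable M" for n
    by (rule random_variable) simp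
  have B: "B \<in> sets M"
    unfolding B_def by measurable
  have "prob B \<le> exp u * exp (- \<Phi>) ^ n" for n :: nat
  proof -
    have int: "integrable M (\<lambda>\<omega>. exp (- \<sigma> (real n) \<omega>))"
    proof (rule integrable_const_bound[where B=1])
      have "0 \<le> \<sigma> (real n) \<omega>" if "\<omega> \<in> space M" for \<omega>
        using mono_onD[OF nondecreasing[OF that], of 0 "real n"] start[OF that] by simp
      then show "AE \<omega> in M. norm (exp (- \<sigma> (real n) \<omega>)) \<le> 1"
        by (intro AE_I2) simp
    qed measurable
    have "exp (- u) * prob B = (\<integral>\<omega>. exp (- u) * indicator B \<omega> \<partial>M)"
      using B by simp
    \<comment> \<open>On \<open>B\<close> the value of \<sigma> at n is at most \<open>u\<close>;
      elsewhere the left integrand is 0.\<close>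
    also have "\<dots> \<le> (\<integral>\<omega>. exp (- \<sigma> (real n) \<omega>) \<partial>M)"
      proof (rule integral_mono[OF _ int])
      show "integrable M (\<lambda>\<omega>. exp (- u) * indicator B \<omega> :: real)"
        using B by (simp add: less_top[symmetric])
    qed (auto simp: indicator_def B_def)
    also have "\<dots> = exp (- \<Phi>) ^ n"
      using laplace[of "real n" 1] by (simp add: \<Phi>_def exp_of_nat_mult[symmetric] algebra_simps)
    finally have "exp u * (exp (- u) * prob B) \<le> exp u * exp (- \<Phi>) ^ n"
      by (rule mult_left_mono) simp
    then show ?thesis
      by (simp add: mult.assoc[symmetric] exp_add[symmetric])
  qed
  moreover have "(\<lambda>n. exp u * exp (- \<Phi>) ^ n) \<longlonglongrightarrow> exp u * 0"
    using laplace_exponent_pos by (intro tendsto_mult_left LIMSEQ_realpow_zero) (auto simp: \<Phi>_def)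
  ultimately have "prob B \<le> 0"
    by (intro LIMSEQ_le_const[of "\<lambda>n. exp u * exp (- \<Phi>) ^ n"]) auto
  then have "B \<in> null_sets M"
    using B by (simp add: null_sets_def emeasure_eq_measure measure_le_0_iff)
  then show ?thesis
  proof (rule AE_I')
    show "{\<omega> \<in> space M. \<not> (\<exists>s>0. u < \<sigma> s \<omega>)} \<subseteq> B"
    proof
      fix \<omega> assume \<omega>: "\<omega> \<in> {\<omega> \<in> space M. \<not> (\<exists>s>0. u < \<sigma> s \<omega>)}"
      have "\<sigma> (real n) \<omega> \<le> u" for n
        using \<omega> start[of \<omega>] that by (cases "n = 0") (force simp: not_less)+
      with \<omega> show "\<omega> \<in> B" by (simp add: B_def)
    qed
  qed
qed

section \<open>Pathwise position of the inverse process\<close>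

context
  fixes \<omega> u
  assumes \<omega>: "\<omega> \<in> space M" and u: "0 \<le> u" and exceeds: "\<exists>s>0. u < \<sigma> s \<omega>"
begin

lemma inverse_process_nonneg: "0 \<le> inverse_process \<sigma> u \<omega>"
  unfolding inverse_process_def using exceeds by (intro cInf_greatest) auto

lemma \<sigma>_above_inverse_process:
  assumes "inverse_process \<sigma> u \<omega> < s"
  shows "u < \<sigma> s \<omega>"
proof -
  from assms obtain r where r: "0 < r" "u < \<sigma> r \<omega>" "r < s"
    unfolding inverse_process_def using exceeds
    by (subst (asm) cInf_less_iff) (auto intro: bdd_belowI[of _ 0])
  then show ?thesis
    using mono_onD[OF nondecreasing[OF \<omega>], of r s] by simp
qed

lemma \<sigma>_below_inverse_process:
  assumes "0 < s" "s < inverse_process \<sigma> u \<omega>"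
  shows "\<sigma> s \<omega> \<le> u"
proof (rule ccontr)
  assume "\<not> \<sigma> s \<omega> \<le> u"
  with assms(1) have "inverse_process \<sigma> u \<omega> \<le> s"
    unfolding inverse_process_def by (intro cInf_lower) (auto intro: bdd_belowI[of _ 0])
  with assms(2) show False by simp
qed

text \<open>Before the inverse process the path is at most \<open>u\<close>, and so is its left
  limit there. If the inverse process is 0, the left limit is 0 by convention.\<close>

lemma age_nonneg: "0 \<le> age \<sigma> u \<omega>"
proof (cases "inverse_process \<sigma> u \<omega> = 0")
  case True
  then show ?thesis using u by (simp add: age_def left_limit_def)
next
  case False
  define l where "l = inverse_process \<sigma> u \<omega>"
  have l: "0 < l"
    using False inverse_process_nonneg by (simp add: l_def)
  \<comment> \<open>The path is monotone only on nonnegative times, so the left limit is taken as a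
    supremum over \<open>{0<..<l}\<close>.\<close>
  have at: "at l within ({..<l} \<inter> {0<..}) = at_left l"
    by (rule at_within_nhd[of _ "{0<..}"]) (use l in auto)
  let ?L = "Sup ((\<lambda>r. \<sigma> r \<omega>) ` ({..<l} \<inter> {0<..}))"
  have "((\<lambda>r. \<sigma> r \<omega>) \<longlongrightarrow> ?L) (at_left l)"
    unfolding at[symmetric]
    by (rule Lim_left_bound[where K=u])
       (use mono_onD[OF nondecreasing[OF \<omega>]] \<sigma>_below_inverse_process in \<open>auto simp: l_def\<close>)
  then have "left_limit \<sigma> l \<omega> = ?L"
    using l by (simp add: left_limit_def tendsto_Lim)
  also have "?L \<le> u"
    using l dense[OF l] \<sigma>_below_inverse_process by (intro cSup_least) (auto simp: l_def)
  finally show ?thesis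
    by (simp add: age_def l_def)
qed

text \<open>To the right of the inverse process the path exceeds \<open>u\<close>; right-continuity
  keeps \<open>\<ge>\<close> in the limit.\<close>

lemma remaining_lifetime_nonneg: "0 \<le> remaining_lifetime \<sigma> u \<omega>"
proof -
  let ?l = "inverse_process \<sigma> u \<omega>"
  have "((\<lambda>s. \<sigma> s \<omega>) \<longlongrightarrow> \<sigma> ?l \<omega>) (at_right ?l)"
    using right_continuous[OF \<omega> inverse_process_nonneg] by (simp add: continuous_within)
  moreover have "\<forall>\<^sub>F s in at_right ?l. u \<le> \<sigma> s \<omega>"
    using eventually_at_right_less by eventually_elim (intro less_imp_le \<sigma>_above_inverse_process)
  ultimately have "u \<le> \<sigma> ?l \<omega>"
    by (rule tendsto_lowerbound) simp
  then show ?thesis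
    by (simp add: remaining_lifetime_def)
qed

end

end

text \<open>
  When \<open>X\<close> is not measurable, its image may fail to be a measure; \<open>distr\<close> is then the null measure.
\<close>

lemma AE_distrI:
  assumes AE: "AE \<omega> in M. P (X \<omega>)" and P: "{x \<in> space N. P x} \<in> sets N"
  shows "AE x in distr M N X. P x"
proof -
  let ?A = "{x \<in> space N. \<not> P x}"
  from AE obtain Z where Z: "{\<omega> \<in> space M. \<not> P (X \<omega>)} \<subseteq> Z" "Z \<in> null_sets M"
    unfolding eventually_ae_filter by blast
  have "emeasure M (X -` ?A \<inter> space M) \<le> emeasure M Z"
    using Z by (intro emeasure_mono) auto
  then have "emeasure (distr M N X) ?A = 0"
    using Z(2) unfolding distr_def emeasure_measure_of_conv by auto
  moreover have "?A \<in> sets N"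
    using P by (rule sets.sets_Collect_neg)
  ultimately show ?thesis
    by (intro AE_I'[of ?A]) (auto simp: null_sets_def)
qed

section \<open>The path procedures\<close>

text \<open>With countably many indices, Borel measurability into the product can be checked
  coordinatewise.\<close>

lemma measurable_fun_upd_borel:
  fixes p :: "'c \<Rightarrow> 'i::countable \<Rightarrow> 'a::second_countable_topology"
  assumes p: "p \<in> N \<rightarrow>\<^sub>M borel" and s: "s \<in> N \<rightarrow>\<^sub>M borel"
  shows "(\<lambda>w. (p w)(i := s w)) \<in> N \<rightarrow>\<^sub>M borel"
proof (rule measurable_coordinatewise_then_product)
  show "(\<lambda>w. ((p w)(i := s w)) j) \<in> N \<rightarrow>\<^sub>M borel" for j
    unfolding fun_upd_apply
    by (intro measurable_If s measurable_compose[OF p measurable_product_coordinates]) simp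
qed

lemma measurable_set_state [measurable (raw)]:
  assumes "s \<in> N \<rightarrow>\<^sub>M borel" "p \<in> N \<rightarrow>\<^sub>M borel"
  shows "(\<lambda>w. set_state i (s w) (p w)) \<in> N \<rightarrow>\<^sub>M prob_algebra borel"
  unfolding set_state_def
  by (intro measurable_tick measurable_result measurable_fun_upd_borel assms)

lemma const_in_prob_algebra:
  assumes "(\<lambda>_::real. m) \<in> borel \<rightarrow>\<^sub>M prob_algebra borel"
  shows "m \<in> space (prob_algebra borel)"
  using measurable_space[OF assms, of 0] by simp

lemma set_state_in_prob_algebra: "set_state i s p \<in> space (prob_algebra borel)"
  by (intro const_in_prob_algebra measurable_set_state measurable_const) simp_all

lemma result_in_prob_algebra:
  "result (a :: 'a::second_countable_topology) \<in> space (prob_algebra borel)"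
  by (intro const_in_prob_algebra measurable_result measurable_const) simp_all

lemma tick_in_prob_algebra:
  fixes m :: "'a::second_countable_topology timed"
  shows "m \<in> space (prob_algebra borel) \<Longrightarrow> tick m \<in> space (prob_algebra borel)"
  by (rule const_in_prob_algebra) (intro measurable_tick measurable_const)

lemma expected_time_set_state: "expected_time (set_state i s p) = 1"
  by (simp add: set_state_def expected_time_tick result_in_prob_algebra expected_time_result)

lemma pred_state_nonneg [measurable]: "Measurable.pred borel (\<lambda>p :: path. 0 \<le> snd (p i))"
proof -
  have "Measurable.pred borel (\<lambda>s :: real \<times> real. 0 \<le> snd s)"
    by measurable
  then show ?thesis
    by (rule measurable_compose[OF measurable_product_coordinates])
qed

lemma AE_set_state:
  "(AE z in set_state i s p. 0 \<le> snd (fst z i)) \<longleftrightarrow> 0 \<le> snd s"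
  unfolding set_state_def
  by (simp only: AE_tick[OF result_in_prob_algebra pred_state_nonneg] AE_result[OF pred_state_nonneg])
     simp

lemma measurable_sample_S [measurable (raw)]:
  assumes \<nu>: "sets \<nu> = sets borel" and [measurable]: "v \<in> N \<rightarrow>\<^sub>M borel"
  shows "(\<lambda>w. sample_S \<nu> (v w)) \<in> N \<rightarrow>\<^sub>M prob_algebra borel"
proof -
  have [measurable]: "(\<lambda>w. draw (uniform_measure lborel {0<..<1::real})) \<in> N \<rightarrow>\<^sub>M prob_algebra borel"
    by (intro measurable_const draw_in_prob_algebra prob_space_uniform_measure) auto
  have "(\<lambda>z. S_inverse_cdf \<nu> (v (fst z)) (snd z)) \<in> N \<Otimes>\<^sub>M borel \<rightarrow>\<^sub>M borel"
    using measurable_compose[OF _ measurable_S_inverse_cdf[OF \<nu>],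
        of "\<lambda>z. (v (fst z), snd z)" "N \<Otimes>\<^sub>M borel"] by simp
  then show ?thesis
    unfolding sample_S_def by (intro measurable_seq) (simp_all add: split_beta')
qed

lemma sample_S_in_prob_algebra:
  "sets \<nu> = sets borel \<Longrightarrow> sample_S \<nu> v \<in> space (prob_algebra borel)"
  by (intro const_in_prob_algebra measurable_sample_S) simp_all

lemma
  assumes \<nu>: "sets \<nu> = sets borel"
  shows expected_time_sample_S: "expected_time (sample_S \<nu> v) = 2"
    and AE_sample_S: "Measurable.pred borel P \<Longrightarrow> (AE z in sample_S \<nu> v. P (fst z)) \<longleftrightarrow>
      (AE u in uniform_measure lborel {0<..<1}. P (S_inverse_cdf \<nu> v u))"
proof -
  let ?D = "draw (uniform_measure lborel {0<..<1::real})"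
  have D: "?D \<in> space (prob_algebra borel)"
    by (intro draw_in_prob_algebra prob_space_uniform_measure) auto
  have tD: "tick ?D \<in> space (prob_algebra borel)"
    by (rule const_in_prob_algebra) (intro measurable_tick measurable_const D)
  interpret tD: prob_space "tick ?D"
    using tD by (simp add: space_prob_algebra)
  have [measurable]: "(\<lambda>u. S_inverse_cdf \<nu> v u) \<in> borel \<rightarrow>\<^sub>M borel"
    using measurable_compose[OF _ measurable_S_inverse_cdf[OF \<nu>], of "\<lambda>u. (v, u)" borel] by simp
  have f: "(\<lambda>u. tick (result (S_inverse_cdf \<nu> v u))) \<in> borel \<rightarrow>\<^sub>M prob_algebra borel"
    by measurable
  show "expected_time (sample_S \<nu> v) = 2"
    unfolding sample_S_def expected_time_seq[OF tD f]
    by (simp add: expected_time_tick D result_in_prob_algebra expected_time_result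
        expected_time_draw tD.emeasure_space_1)
  show "(AE z in sample_S \<nu> v. P (fst z)) \<longleftrightarrow>
      (AE u in uniform_measure lborel {0<..<1}. P (S_inverse_cdf \<nu> v u))"
    if P [measurable]: "Measurable.pred borel P"
  proof -
    have P': "Measurable.pred borel (\<lambda>u. P (S_inverse_cdf \<nu> v u))"
      by measurable
    show ?thesis
      unfolding sample_S_def AE_seq[OF tD f P]
      by (simp only: AE_tick[OF result_in_prob_algebra P] AE_result[OF P] AE_tick[OF D P'])
         (rule AE_draw[OF _ P'], simp)
  qed
qed

text \<open>The uniform variable almost surely lies strictly between 0 and 1. The bound keeps the
  call time \<open>d + v - S\<close> of the age step at most \<open>d\<close>.\<close>

lemma (in subordinator) AE_sample_S_ge:
  assumes "0 < v"
  shows "AE z in sample_S \<nu> v. v \<le> fst z"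
proof -
  have "AE u in uniform_measure lborel {0<..<1}. v \<le> S_inverse_cdf \<nu> v u"
    by (rule AE_uniform_measureI) (use S_inverse_cdf_ge[OF assms] in auto)
  then show ?thesis
    by (subst AE_sample_S[OF levy_sets]) simp_all
qed

section \<open>Cost and invariant of a single loop pass\<close>

context
  fixes sub :: "real \<Rightarrow> (real \<times> real) timed"
  assumes sub [measurable]: "sub \<in> borel \<rightarrow>\<^sub>M prob_algebra borel"
begin

lemma measurable_renew [measurable (raw)]:
  assumes [measurable]: "u \<in> N \<rightarrow>\<^sub>M borel" "x \<in> N \<rightarrow>\<^sub>M borel" "p \<in> N \<rightarrow>\<^sub>M borel"
  shows "(\<lambda>w. renew sub (u w) i (x w) (p w)) \<in> N \<rightarrow>\<^sub>M prob_algebra borel"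
  unfolding renew_def split_beta' by measurable

lemma renew_in_prob_algebra: "renew sub u i x p \<in> space (prob_algebra borel)"
  by (rule const_in_prob_algebra) measurable

lemma measurable_lifetime_step: "lifetime_step sub t i \<in> borel \<rightarrow>\<^sub>M prob_algebra borel"
  unfolding lifetime_step_def Let_def split_beta' by measurable

lemma measurable_age_step:
  assumes "sets \<nu> = sets borel"
  shows "age_step \<nu> sub t i \<in> borel \<rightarrow>\<^sub>M prob_algebra borel"
proof -
  note measurable_sample_S[OF assms, measurable (raw)]
  have [measurable]: "(\<lambda>w. p w (i - 1)) \<in> N \<rightarrow>\<^sub>M borel" if "p \<in> N \<rightarrow>\<^sub>M borel" for N and p :: "'c \<Rightarrow> path"
    by (rule measurable_compose[OF that measurable_product_coordinates])
  show ?thesis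
    unfolding age_step_def Let_def split_beta' by measurable
qed

lemma expected_time_renew: "expected_time (renew sub u i x p) = expected_time (sub u) + 1"
  and AE_renew: "(AE z in renew sub u i x p. 0 \<le> snd (fst z i)) \<longleftrightarrow> (AE z in sub u. 0 \<le> snd (fst z))"
proof -
  have s: "sub u \<in> space (prob_algebra borel)"
    using measurable_space[OF sub, of u] by simp
  then interpret prob_space "sub u"
    by (simp add: space_prob_algebra)
  have f: "(\<lambda>(l, g). set_state i (x + l, g) p) \<in> borel \<rightarrow>\<^sub>M prob_algebra borel"
    unfolding split_beta' by measurable
  show "expected_time (renew sub u i x p) = expected_time (sub u) + 1"
    unfolding renew_def expected_time_seq[OF s f]
    by (simp add: split_beta expected_time_set_state emeasure_space_1)
  show "(AE z in renew sub u i x p. 0 \<le> snd (fst z i)) \<longleftrightarrow> (AE z in sub u. 0 \<le> snd (fst z))"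
    unfolding renew_def AE_seq[OF s f pred_state_nonneg]
    by (intro AE_cong) (auto simp only: AE_set_state snd_conv split: prod.split)
qed

context
  fixes t :: "nat \<Rightarrow> real" and i :: nat and p :: path and C :: ennreal
  assumes step: "t (i - 1) \<le> t i"
    and state: "0 \<le> snd (p (i - 1))"
    and cost: "\<And>u. 0 \<le> u \<Longrightarrow> u \<le> t i - t (i - 1) \<Longrightarrow> expected_time (sub u) \<le> C"
    and nonneg: "\<And>u. 0 \<le> u \<Longrightarrow> AE z in sub u. 0 \<le> snd (fst z)"
begin

text \<open>Loop step, reading, test and assignment make 4. The call time \<open>d - r\<close> lies
  between 0 and \<open>d\<close>, because \<open>r\<close> is nonnegative and the test has
  failed.\<close>

lemma lifetime_step_bound:
  "expected_time (lifetime_step sub t i p) \<le> C + 4"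
  "AE z in lifetime_step sub t i p. 0 \<le> snd (fst z i)"
proof -
  obtain x r where p: "p (i - 1) = (x, r)"
    by fastforce
  then have r: "0 \<le> r"
    using state by simp
  define d where "d = t i - t (i - 1)"
  define m where "m = (if r > d then set_state i (x, r - d) p else renew sub (d - r) i x p)"
  have eq: "lifetime_step sub t i p = tick (tick (tick m))"
    unfolding lifetime_step_def p Let_def prod.case m_def d_def ..
  have m: "m \<in> space (prob_algebra borel)"
    by (simp add: m_def set_state_in_prob_algebra renew_in_prob_algebra)
  have "expected_time m \<le> C + 1"
    using cost[folded d_def, of "d - r"] r
    by (auto simp: m_def expected_time_set_state expected_time_renew add_increasing)
  then have "1 + (1 + (1 + expected_time m)) \<le> 1 + (1 + (1 + (C + 1)))"
    by (intro add_left_mono)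
  then show "expected_time (lifetime_step sub t i p) \<le> C + 4"
    by (simp add: eq expected_time_tick tick_in_prob_algebra m ac_simps)
  show "AE z in lifetime_step sub t i p. 0 \<le> snd (fst z i)"
    unfolding eq AE_tick[OF tick_in_prob_algebra[OF tick_in_prob_algebra[OF m]] pred_state_nonneg]
      AE_tick[OF tick_in_prob_algebra[OF m] pred_state_nonneg] AE_tick[OF m pred_state_nonneg]
    using nonneg[of "d - r"] by (cases "r > d") (auto simp only: m_def AE_set_state AE_renew if_True if_False snd_conv)
qed

text \<open>The costliest branch has \<open>v > 0\<close>: loop step, reading, first test, 2 for the
  sample, second test and assignment make 7, besides one call.\<close>

lemma age_step_bound:
  assumes \<nu>: "sets \<nu> = sets borel"
    and S: "\<And>v. 0 < v \<Longrightarrow> AE z in sample_S \<nu> v. v \<le> fst z"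
  shows "expected_time (age_step \<nu> sub t i p) \<le> C + 7"
    and "AE z in age_step \<nu> sub t i p. 0 \<le> snd (fst z i)"
proof -
  obtain x v where p: "p (i - 1) = (x, v)"
    by fastforce
  then have v: "0 \<le> v"
    using state by simp
  define d where "d = t i - t (i - 1)"
  have d: "0 \<le> d"
    using step by (simp add: d_def)
  define g where "g S = (if S \<ge> v + d then set_state i (x, v + d) p
    else renew sub (d + v - S) i x p)" for S
  define f where "f S = tick (g S)" for S
  define m where "m = (if v = 0 then renew sub d i x p else seq (sample_S \<nu> v) f)"
  have eq: "age_step \<nu> sub t i p = tick (tick (tick m))"
    unfolding age_step_def p Let_def prod.case m_def f_def[abs_def] g_def d_def ..
  have g: "g S \<in> space (prob_algebra borel)" for S
    by (simp add: g_def set_state_in_prob_algebra renew_in_prob_algebra)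
  have f [measurable]: "f \<in> borel \<rightarrow>\<^sub>M prob_algebra borel"
    unfolding f_def[abs_def] g_def by measurable
  note sample = sample_S_in_prob_algebra[OF \<nu>, of v]
  have m: "m \<in> space (prob_algebra borel)"
  proof -
    have "seq (sample_S \<nu> v) f \<in> space (prob_algebra borel)"
      by (rule const_in_prob_algebra) (use sample in measurable)
    then show ?thesis by (simp add: m_def renew_in_prob_algebra)
  qed
  have f_cost: "expected_time (f S) \<le> C + 2" if "v \<le> S" for S
  proof -
    have "expected_time (g S) \<le> C + 1"
      using cost[folded d_def, of "d + v - S"] that
      by (auto simp: g_def expected_time_set_state expected_time_renew add_increasing)
    then have "1 + expected_time (g S) \<le> 1 + (C + 1)"
      by (rule add_left_mono)
    then show ?thesis
      by (simp add: f_def expected_time_tick g ac_simps)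
  qed
  \<comment> \<open>Only the sign of the call time matters here, and the failed test makes it
    positive for every \<open>S\<close>.\<close>
  have f_inv: "AE w in f S. 0 \<le> snd (fst w i)" for S
    unfolding f_def AE_tick[OF g pred_state_nonneg]
    using nonneg[of "d + v - S"] v d
    by (cases "S \<ge> v + d") (auto simp only: g_def AE_set_state AE_renew if_True if_False snd_conv)
  have "expected_time m \<le> C + 4"
  proof (cases "v = 0")
    case True
    have "expected_time (sub d) + 1 \<le> C + 4"
      by (intro add_mono cost[folded d_def]) (simp_all add: d)
    with True show ?thesis
      by (simp add: m_def expected_time_renew)
  next
    case False
    have "AE z in sample_S \<nu> v. expected_time (f (fst z)) \<le> C + 2"
      using S[of v] False v by (auto intro: f_cost)
    from expected_time_seq_le[OF sample f this] False show ?thesis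
      by (simp add: m_def expected_time_sample_S[OF \<nu>] ac_simps)
  qed
  then have "1 + (1 + (1 + expected_time m)) \<le> 1 + (1 + (1 + (C + 4)))"
    by (intro add_left_mono)
  then show "expected_time (age_step \<nu> sub t i p) \<le> C + 7"
    by (simp add: eq expected_time_tick tick_in_prob_algebra m ac_simps)
  show "AE z in age_step \<nu> sub t i p. 0 \<le> snd (fst z i)"
    unfolding eq AE_tick[OF tick_in_prob_algebra[OF tick_in_prob_algebra[OF m]] pred_state_nonneg]
      AE_tick[OF tick_in_prob_algebra[OF m] pred_state_nonneg] AE_tick[OF m pred_state_nonneg]
  proof (cases "v = 0")
    case True
    then have "m = renew sub d i x p"
      by (simp add: m_def)
    then show "AE z in m. 0 \<le> snd (fst z i)"
      using nonneg[OF d] by (simp only: AE_renew)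
  next
    case False
    then have "m = seq (sample_S \<nu> v) f"
      by (simp add: m_def)
    then show "AE z in m. 0 \<le> snd (fst z i)"
      using f_inv by (simp only: AE_seq[OF sample f pred_state_nonneg] eventually_True)
  qed
qed

end

end

section \<open>From the given subroutines to the whole loop\<close>

lemma run_loop_cong:
  "(\<And>i. i < n \<Longrightarrow> step (Suc i) = step' (Suc i)) \<Longrightarrow> run_loop step s n = run_loop step' s n"
  by (induction n) auto

text \<open>
  The subroutine is only measurable in nonnegative times; as the procedures never call it elsewhere,
  it may be replaced by \<open>\<lambda>u. sub (max 0 u)\<close>, which is measurable on the whole line.
\<close>

lemma measurable_sampling_subroutine:
  assumes "sampling_subroutine law sub"
  shows "(\<lambda>u. sub (max 0 u)) \<in> borel \<rightarrow>\<^sub>M prob_algebra borel"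
proof (rule measurable_compose[of "\<lambda>u. max 0 u"])
  show "(\<lambda>u::real. max 0 u) \<in> borel \<rightarrow>\<^sub>M restrict_space borel {0..}"
    by (rule measurable_restrict_space2) auto
  show "sub \<in> restrict_space borel {0..} \<rightarrow>\<^sub>M prob_algebra borel"
    using assms by (simp add: sampling_subroutine_def)
qed

text \<open>For \<open>v = 0\<close> the call time is the step length, whence the ordering of the
  times; otherwise the failed test makes it positive.\<close>

lemma age_step_clip:
  "t (i - 1) \<le> t i \<Longrightarrow> age_step \<nu> (\<lambda>u. sub (max 0 u)) t i = age_step \<nu> sub t i"
  unfolding age_step_def renew_def Let_def
  by (intro ext arg_cong[where f=tick] prod.case_cong if_cong arg_cong[where f="seq _"] refl
      arg_cong2[where f=seq]) auto

lemma lifetime_step_clip: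
  "lifetime_step (\<lambda>u. sub (max 0 u)) t i = lifetime_step sub t i"
  unfolding lifetime_step_def renew_def Let_def
  by (intro ext arg_cong[where f=tick] prod.case_cong if_cong arg_cong2[where f=seq] refl) auto

lemma AE_sampling_subroutine:
  assumes sub: "sampling_subroutine (\<lambda>u. distr M borel (X u)) sub"
    and u: "0 \<le> u" and AE: "AE \<omega> in M. 0 \<le> snd (X u \<omega>)"
  shows "AE z in sub u. 0 \<le> snd (fst z :: real \<times> real)"
proof -
  have [measurable_cong]: "sets (sub u) = sets borel"
    using measurable_space[OF measurable_sampling_subroutine[OF sub], of u] u
    by (simp add: space_prob_algebra)
  have eq: "distr (sub u) borel fst = distr M borel (X u)"
    using sub u by (simp add: sampling_subroutine_def output_law_def)
  \<comment> \<open>\<open>X u\<close> is not assumed measurable, hence the use of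
    \<open>AE_distrI\<close>.\<close>
  have "AE y in distr (sub u) borel fst. 0 \<le> snd y"
    unfolding eq using AE_distrI[where P="\<lambda>y. 0 \<le> snd y" and X="X u" and N=borel, OF AE]
    by simp
  then show ?thesis
    by (subst (asm) AE_distr_iff) simp_all
qed

lemma (in strictly_increasing_subordinator)
  assumes "0 \<le> u"
  shows AE_age_nonneg: "AE \<omega> in M. 0 \<le> age \<sigma> u \<omega>"
    and AE_remaining_lifetime_nonneg: "AE \<omega> in M. 0 \<le> remaining_lifetime \<sigma> u \<omega>"
proof -
  show "AE \<omega> in M. 0 \<le> age \<sigma> u \<omega>"
    using AE_exceeds[OF assms] AE_space by eventually_elim (intro age_nonneg assms)
  show "AE \<omega> in M. 0 \<le> remaining_lifetime \<sigma> u \<omega>"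
    using AE_exceeds[OF assms] AE_space by eventually_elim (intro remaining_lifetime_nonneg assms)
qed

theorem proposition3p1:
  fixes M :: "'w measure"
    and \<sigma> :: "real \<Rightarrow> 'w \<Rightarrow> real"
    and b :: real
    and \<nu> :: "real measure"
    and sub_age sub_life :: "real \<Rightarrow> (real \<times> real) timed"
    and K_age K_life :: "real \<Rightarrow> ennreal"
    and x0 v0 r0 h :: real
    and t :: "nat \<Rightarrow> real"
    and n :: nat
  assumes "strictly_increasing_subordinator M \<sigma> b \<nu>"
    and "sampling_subroutine
           (\<lambda>u. distr M borel (\<lambda>\<omega>. (inverse_process \<sigma> u \<omega>, age \<sigma> u \<omega>))) sub_age"
    and "sampling_subroutine
           (\<lambda>u. distr M borel (\<lambda>\<omega>. (inverse_process \<sigma> u \<omega>, remaining_lifetime \<sigma> u \<omega>))) sub_life"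
    and "\<And>u. 0 \<le> u \<Longrightarrow> K_age u = expected_time (sub_age u)"
    and "\<And>u. 0 \<le> u \<Longrightarrow> K_life u = expected_time (sub_life u)"
    and "\<And>T. (SUP u\<in>{0..T}. K_age u) < \<infinity>"
    and "\<And>T. (SUP u\<in>{0..T}. K_life u) < \<infinity>"
    and "mono_on {0..} K_age"
    and "mono_on {0..} K_life"
    and "0 \<le> v0" and "0 \<le> r0"
    and "1 \<le> n"
    and "\<And>i. i < n \<Longrightarrow> t i < t (Suc i)"
    and "h = Max ((\<lambda>k. t k - t (k - 1)) ` {1..n})"
  shows "expected_time (age_path_procedure \<nu> sub_age x0 v0 t n) < \<infinity> \<and>
         expected_time (age_path_procedure \<nu> sub_age x0 v0 t n) \<le> of_nat n * (K_age h + 7) \<and>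
         expected_time (lifetime_path_procedure sub_life x0 r0 t n) < \<infinity> \<and>
         expected_time (lifetime_path_procedure sub_life x0 r0 t n) \<le> of_nat n * (K_life h + 4)"
proof -
  interpret strictly_increasing_subordinator M \<sigma> b \<nu>
    by fact
  let ?age = "\<lambda>u. sub_age (max 0 u)" and ?life = "\<lambda>u. sub_life (max 0 u)"
  have step: "t i \<le> t (Suc i)" if "i < n" for i
    using assms(13)[OF that] by simp
  have h: "t (Suc i) - t i \<le> h" if "i < n" for i
    unfolding assms(14) using that by (intro Max_ge) (auto intro!: image_eqI[of _ _ "Suc i"])
  \<comment> \<open>This puts \<open>h\<close> into the domain on which the cost functions are
    monotone.\<close>
  have "0 \<le> h"
    using h[of 0] step[of 0] \<open>1 \<le> n\<close> by simp
  have age_cost: "expected_time (?age u) \<le> K_age h" and life_cost: "expected_time (?life u) \<le> K_life h"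
    if "0 \<le> u" "u \<le> t (Suc i) - t i" "i < n" for u i
    using that h[OF that(3)] \<open>0 \<le> h\<close> mono_onD[OF assms(8), of u h] mono_onD[OF assms(9), of u h]
    by (simp_all add: assms(4,5))
  have age_nonneg: "AE z in ?age u. 0 \<le> snd (fst z)"
    and life_nonneg: "AE z in ?life u. 0 \<le> snd (fst z)" for u
    using AE_sampling_subroutine[OF assms(2), of "max 0 u"] AE_age_nonneg[of "max 0 u"]
      AE_sampling_subroutine[OF assms(3), of "max 0 u"] AE_remaining_lifetime_nonneg[of "max 0 u"]
    by simp_all
  note age_meas = measurable_sampling_subroutine[OF assms(2)]
    and life_meas = measurable_sampling_subroutine[OF assms(3)]
  have "age_path_procedure \<nu> sub_age x0 v0 t n = run_loop (age_step \<nu> ?age t) (x0, v0) n"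
    unfolding age_path_procedure_def
    by (intro run_loop_cong age_step_clip[symmetric]) (simp add: step)
  also have "expected_time \<dots> \<le> of_nat n * (K_age h + 7)"
  proof (rule run_loop_bound[where P="\<lambda>s. 0 \<le> snd s"])
    fix i p assume i: "i < n" and "0 \<le> snd (p i :: real \<times> real)"
    then have "t (Suc i - 1) \<le> t (Suc i)" "0 \<le> snd (p (Suc i - 1))"
      "\<And>u. 0 \<le> u \<Longrightarrow> u \<le> t (Suc i) - t (Suc i - 1) \<Longrightarrow> expected_time (?age u) \<le> K_age h"
      using step[OF i] age_cost[OF _ _ i] by simp_all
    note bound = age_step_bound[where sub="?age" and t=t and i="Suc i" and p=p, OF age_meas this age_nonneg levy_sets AE_sample_S_ge]
    show "expected_time (age_step \<nu> ?age t (Suc i) p) \<le> K_age h + 7"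
      by (rule bound(1))
    show "AE z in age_step \<nu> ?age t (Suc i) p. 0 \<le> snd (fst z (Suc i))"
      by (rule bound(2))
  qed (use \<open>0 \<le> v0\<close> measurable_age_step[OF age_meas levy_sets] in simp_all)
  finally have age: "expected_time (age_path_procedure \<nu> sub_age x0 v0 t n) \<le> of_nat n * (K_age h + 7)" .
  have "lifetime_path_procedure sub_life x0 r0 t n = run_loop (lifetime_step ?life t) (x0, r0) n"
    unfolding lifetime_path_procedure_def lifetime_step_clip ..
  also have "expected_time \<dots> \<le> of_nat n * (K_life h + 4)"
  proof (rule run_loop_bound[where P="\<lambda>s. 0 \<le> snd s"])
    fix i p assume i: "i < n" and "0 \<le> snd (p i :: real \<times> real)"
    then have "t (Suc i - 1) \<le> t (Suc i)" "0 \<le> snd (p (Suc i - 1))"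
      "\<And>u. 0 \<le> u \<Longrightarrow> u \<le> t (Suc i) - t (Suc i - 1) \<Longrightarrow> expected_time (?life u) \<le> K_life h"
      using step[OF i] life_cost[OF _ _ i] by simp_all
    note bound = lifetime_step_bound[where sub="?life" and t=t and i="Suc i" and p=p, OF life_meas this life_nonneg]
    show "expected_time (lifetime_step ?life t (Suc i) p) \<le> K_life h + 4"
      by (rule bound(1))
    show "AE z in lifetime_step ?life t (Suc i) p. 0 \<le> snd (fst z (Suc i))"
      by (rule bound(2))
  qed (use \<open>0 \<le> r0\<close> measurable_lifetime_step[OF life_meas] in simp_all)
  finally have life: "expected_time (lifetime_path_procedure sub_life x0 r0 t n) \<le> of_nat n * (K_life h + 4)" .
  \<comment> \<open>With \<open>T = h\<close>, the value at \<open>h\<close> is among those whose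
    supremum is finite.\<close>
  have "K_age h < \<infinity>" "K_life h < \<infinity>"
    using le_less_trans[OF SUP_upper assms(6), of h h] le_less_trans[OF SUP_upper assms(7), of h h]
      \<open>0 \<le> h\<close> by simp_all
  then have "of_nat n * (K_age h + 7) < \<infinity>" "of_nat n * (K_life h + 4) < \<infinity>"
    by (simp_all add: ennreal_mult_less_top of_nat_less_top)
  with age life show ?thesis
    by (intro conjI le_less_trans[OF age] le_less_trans[OF life]) simp_all
qed

end
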